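(* If $G$ is a connected graph that is not a complete graph and $3 \le \Delta(G)$, then \[\operatorname{Z}(G) \le (\Delta(G)-1)\,\alpha(G).\]
   Context: All graphs are simple, finite and undirected. $\Delta(G)$ is the maximum degree and $\alpha(G)$ the independence number of $G$. Zero forcing: given a set $B\subseteq V(G)$ of initially blue vertices (the rest white), if a blue vertex has exactly one white neighbor $w$, it can force $w$ to become blue; this rule is applied repeatedly. $B$ is a zero forcing set if all vertices can eventually become blue. $\operatorname{Z}(G)$ is the minimum cardinality of a zero forcing set of $G$. *)

theory Defs
  imports "Graph_Theory.Digraph_Component" "Graph_Theory.Kuratowski"
begin

text \<open>
  A simple, finite, undirected graph is a \<^locale>\<open>graph\<close>: a finite symmetric digraph without
  loops and parallel arcs. Each undirected edge is a pair of opposite arcs, so the degree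
  of a vertex is its out-degree.
\<close>

definition max_degree :: "('a,'b) pre_digraph \<Rightarrow> nat" where
  "max_degree G = Max (out_degree G ` verts G)"

definition independent_set :: "('a,'b) pre_digraph \<Rightarrow> 'a set \<Rightarrow> bool" where
  "independent_set G S \<longleftrightarrow> S \<subseteq> verts G \<and> (\<forall>u\<in>S. \<forall>v\<in>S. \<not> u \<rightarrow>\<^bsub>G\<^esub> v)"

definition independence_number :: "('a,'b) pre_digraph \<Rightarrow> nat" where
  "independence_number G = Max (card ` {S. independent_set G S})"

text \<open>
  A colouring is given by its set of blue vertices; \<open>force_step G B B'\<close> performs a single force.
\<close>

definition white_neighbors :: "('a,'b) pre_digraph \<Rightarrow> 'a set \<Rightarrow> 'a \<Rightarrow> 'a set" where
  "white_neighbors G B u = {w. u \<rightarrow>\<^bsub>G\<^esub> w \<and> w \<notin> B}"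

definition force_step :: "('a,'b) pre_digraph \<Rightarrow> 'a set \<Rightarrow> 'a set \<Rightarrow> bool" where
  "force_step G B B' \<longleftrightarrow> (\<exists>u\<in>B. \<exists>w. white_neighbors G B u = {w} \<and> B' = insert w B)"

definition zero_forcing_set :: "('a,'b) pre_digraph \<Rightarrow> 'a set \<Rightarrow> bool" where
  "zero_forcing_set G B \<longleftrightarrow> B \<subseteq> verts G \<and> (force_step G)\<^sup>*\<^sup>* B (verts G)"

definition zero_forcing_number :: "('a,'b) pre_digraph \<Rightarrow> nat" where
  "zero_forcing_number G = Min (card ` {B. zero_forcing_set G B})"

text \<open>
  The sets under \<^const>\<open>Max\<close> and \<^const>\<open>Min\<close> are finite and nonempty, so these values are attained.
\<close>

lemma (in graph) max_degree_attained:
  assumes "verts G \<noteq> {}"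
  shows "\<exists>v\<in>verts G. out_degree G v = max_degree G"
proof -
  have "max_degree G \<in> out_degree G ` verts G"
    unfolding max_degree_def using assms by (intro Max_in) auto
  then show ?thesis by force
qed

lemma (in graph) independence_number_attained:
  "\<exists>S. independent_set G S \<and> card S = independence_number G"
proof -
  have "{S. independent_set G S} \<subseteq> Pow (verts G)"
    by (auto simp: independent_set_def)
  then have "finite {S. independent_set G S}"
    by (rule finite_subset) simp
  moreover have "independent_set G {}"
    by (simp add: independent_set_def)
  ultimately have "independence_number G \<in> card ` {S. independent_set G S}"
    unfolding independence_number_def by (intro Max_in) auto
  then show ?thesis by force
qed

lemma (in graph) zero_forcing_number_attained:
  "\<exists>B. zero_forcing_set G B \<and> card B = zero_forcing_number G"
proof -
  have "{B. zero_forcing_set G B} \<subseteq> Pow (verts G)"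
    by (auto simp: zero_forcing_set_def)
  then have "finite {B. zero_forcing_set G B}"
    by (rule finite_subset) simp
  moreover have "zero_forcing_set G (verts G)"
    by (simp add: zero_forcing_set_def)
  ultimately have "zero_forcing_number G \<in> card ` {B. zero_forcing_set G B}"
    unfolding zero_forcing_number_def by (intro Min_in) auto
  then show ?thesis by force
qed

end

theory Submission
  imports Defs
begin

text \<open>
  Let \<open>\<Delta>\<close> be the maximum degree, \<open>\<alpha>\<close> the independence number and \<open>n\<close> the order of \<open>G\<close>. Two greedy
  constructions, each growing a vertex set across its boundary until connectivity makes it
  exhaust the graph, give
  \<open>(\<Delta> - 1) Z(G) \<le> (\<Delta> - 2) n + 2\<close> (\<open>zero_forcing_set_card_bound\<close>) and
  \<open>n \<le> \<Delta> \<alpha> + 1\<close> (\<open>order_le_independent_set\<close>).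

  Since \<open>(\<Delta> - 2) \<Delta> = (\<Delta> - 1)\<^sup>2 - 1\<close>, substituting the second bound into the first yields
  \<open>(\<Delta> - 1) Z(G) \<le> (\<Delta> - 1)\<^sup>2 \<alpha> + (\<Delta> - \<alpha>)\<close>. A graph that is not complete has
  \<open>\<alpha> \<ge> 2\<close>, so the error term \<open>\<Delta> - \<alpha>\<close> is smaller than \<open>\<Delta> - 1\<close> and disappears by integrality.
\<close>

section \<open>Growing vertex sets in a connected graph\<close>

lemma growing_subset_exhausts:
  assumes "finite V" and "D \<subseteq> V" and "P D"
    and grow: "\<And>D. P D \<Longrightarrow> D \<subset> V \<Longrightarrow> \<exists>D'. D \<subset> D' \<and> D' \<subseteq> V \<and> P D'"
  shows "P V"
proof -
  have "finite {D. D \<subseteq> V \<and> P D}" using \<open>finite V\<close> by simp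
  moreover have "{D. D \<subseteq> V \<and> P D} \<noteq> {}" using assms(2,3) by blast
  ultimately obtain M where "M \<subseteq> V" "P M"
    and max: "\<forall>D\<in>{D. D \<subseteq> V \<and> P D}. M \<subseteq> D \<longrightarrow> M = D"
    using finite_has_maximal[of "{D. D \<subseteq> V \<and> P D}"] by auto
  have "M = V"
  proof (rule ccontr)
    assume "M \<noteq> V"
    with \<open>M \<subseteq> V\<close> grow[OF \<open>P M\<close>] obtain D' where "M \<subset> D'" "D' \<subseteq> V" "P D'" by blast
    with max show False by blast
  qed
  with \<open>P M\<close> show ?thesis by simp
qed

lemma (in sym_digraph) connected_boundary_arc:
  assumes "Digraph_Component.connected G" and "D \<noteq> {}" and "D \<subset> verts G"
  obtains u w where "u \<in> D" and "w \<in> verts G - D" and "u \<rightarrow>\<^bsub>G\<^esub> w"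
proof -
  obtain x y where x: "x \<in> D" and y: "y \<in> verts G - D" using assms(2,3) by blast
  have "strongly_connected G"
    using symmetric_connected_imp_strongly_connected sym_arcs assms(1) by blast
  then have "x \<rightarrow>\<^sup>*\<^bsub>G\<^esub> y" using assms(3) x y unfolding strongly_connected_def by blast
  moreover have "a \<in> D" if "x \<rightarrow>\<^sup>*\<^bsub>G\<^esub> a" and no: "\<not> (\<exists>u\<in>D. \<exists>w\<in>verts G - D. u \<rightarrow>\<^bsub>G\<^esub> w)" for a
    using that(1)
  proof (induction rule: reachable_induct)
    case base
    show ?case by (rule x)
  next
    case (step b c)
    then show ?case using no adj_in_verts by blast
  qed
  ultimately show ?thesis using y that by blast
qed

lemma (in graph) card_dominated_le_max_degree:
  assumes "u \<in> verts G"
  shows "card {w. u \<rightarrow>\<^bsub>G\<^esub> w} \<le> max_degree G"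
proof -
  have "{w. u \<rightarrow>\<^bsub>G\<^esub> w} \<subseteq> head G ` out_arcs G u" by (auto simp: out_arcs_def)
  then have "card {w. u \<rightarrow>\<^bsub>G\<^esub> w} \<le> card (head G ` out_arcs G u)"
    by (intro card_mono) (auto simp: out_arcs_def)
  also have "\<dots> \<le> out_degree G u"
    unfolding out_degree_def by (rule card_image_le) (simp add: out_arcs_def)
  also have "\<dots> \<le> max_degree G"
    unfolding max_degree_def using assms by (intro Max_ge) auto
  finally show ?thesis .
qed

lemma (in graph) finite_dominated: "finite {w. u \<rightarrow>\<^bsub>G\<^esub> w}"
  by (rule finite_subset[OF _ finite_verts]) (auto dest: adj_in_verts)

text \<open>
  A vertex with a neighbour already inside \<open>D\<close> has at most \<open>\<Delta> - 1\<close> neighbours outside.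
  Both constructions owe their saving over the trivial count to this.
\<close>

lemma (in graph) card_dominated_outside:
  assumes "u \<rightarrow>\<^bsub>G\<^esub> x" and "x \<in> D"
  shows "card ({w. u \<rightarrow>\<^bsub>G\<^esub> w} - D) + 1 \<le> max_degree G"
proof -
  have "{w. u \<rightarrow>\<^bsub>G\<^esub> w} - D \<subset> {w. u \<rightarrow>\<^bsub>G\<^esub> w}" using assms by blast
  then have "card ({w. u \<rightarrow>\<^bsub>G\<^esub> w} - D) < card {w. u \<rightarrow>\<^bsub>G\<^esub> w}"
    using finite_dominated by (rule psubset_card_mono[rotated])
  moreover have "u \<in> verts G" using assms(1) adj_in_verts by blast
  ultimately show ?thesis using card_dominated_le_max_degree[of u] by linarith
qed

section \<open>Order and independence number\<close>

text \<open>
  Select vertices one at a time, discarding with each its closed neighbourhood. The first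
  selection discards at most \<open>\<Delta> + 1\<close> vertices; every later one is made next to a discarded
  vertex and so discards at most \<open>\<Delta>\<close> new ones.
\<close>

lemma (in graph) order_le_independent_set:
  assumes conn: "Digraph_Component.connected G"
  shows "\<exists>S. independent_set G S \<and> card (verts G) \<le> max_degree G * card S + 1"
proof -
  let ?N = "\<lambda>u. {w. u \<rightarrow>\<^bsub>G\<^esub> w}"
  define P where "P D \<longleftrightarrow> D \<noteq> {} \<and> (\<exists>S. independent_set G S \<and> S \<subseteq> D \<and>
    (\<forall>u\<in>S. ?N u \<subseteq> D) \<and> card D \<le> max_degree G * card S + 1)" for D
  obtain v where v: "v \<in> verts G"
    using conn unfolding Digraph_Component.connected_def strongly_connected_def by auto
  have "P (verts G)"
  proof (rule growing_subset_exhausts[of _ "insert v (?N v)"])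
    show "finite (verts G)" by simp
    show "insert v (?N v) \<subseteq> verts G" using v by (auto dest: adj_in_verts)
    have "card (insert v (?N v)) \<le> max_degree G * card {v} + 1"
      using card_insert_le_m1[of "max_degree G + 1" "?N v" v]
        card_dominated_le_max_degree[OF v] by simp
    moreover have "independent_set G {v}"
      using v by (auto simp: independent_set_def dest: adj_not_same)
    ultimately show "P (insert v (?N v))" unfolding P_def by blast
  next
    fix D assume "P D" and D: "D \<subset> verts G"
    then obtain S where ne: "D \<noteq> {}" and S: "independent_set G S" "S \<subseteq> D"
      and NS: "\<forall>u\<in>S. ?N u \<subseteq> D" and le: "card D \<le> max_degree G * card S + 1"
      unfolding P_def by blast
    obtain x w where x: "x \<in> D" and w: "w \<in> verts G - D" and xw: "x \<rightarrow>\<^bsub>G\<^esub> w"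
      by (rule connected_boundary_arc[OF conn ne D])
    have wx: "w \<rightarrow>\<^bsub>G\<^esub> x" using arcs_ends_symmetric[OF sym_arcs xw] .
    let ?D = "D \<union> insert w (?N w - D)"
    have fin: "finite D" "finite S"
      using D S(2) finite_verts by (meson finite_subset psubset_imp_subset)+
    have "card ?D \<le> card D + card (insert w (?N w - D))" by (rule card_Un_le)
    also have "\<dots> \<le> card D + (card (?N w - D) + 1)"
      using finite_dominated[of w] by (simp add: card_insert_if)
    also have "\<dots> \<le> max_degree G * card S + 1 + max_degree G"
      using card_dominated_outside[OF wx x] le by linarith
    also have "\<dots> = max_degree G * card (insert w S) + 1"
      using fin S(2) w by (subst card_insert_disjoint) auto
    finally have "card ?D \<le> max_degree G * card (insert w S) + 1" .
    moreover have "independent_set G (insert w S)"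
      unfolding independent_set_def
    proof (intro conjI ballI)
      show "insert w S \<subseteq> verts G" using S w by (auto simp: independent_set_def)
      fix a b assume ab: "a \<in> insert w S" "b \<in> insert w S"
      show "\<not> a \<rightarrow>\<^bsub>G\<^esub> b"
      proof
        assume e: "a \<rightarrow>\<^bsub>G\<^esub> b"
        then have "b \<rightarrow>\<^bsub>G\<^esub> a" by (rule arcs_ends_symmetric[OF sym_arcs])
        with e ab S NS w show False
          by (auto simp: independent_set_def dest: adj_not_same)
      qed
    qed
    moreover have "\<forall>u\<in>insert w S. ?N u \<subseteq> ?D" using NS by blast
    ultimately have "P ?D" using S(2) ne unfolding P_def by (intro conjI exI[of _ "insert w S"]) auto
    moreover have "D \<subset> ?D" using w by blast
    moreover have "?D \<subseteq> verts G" using D w by (auto dest: adj_in_verts)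
    ultimately show "\<exists>D'. D \<subset> D' \<and> D' \<subseteq> verts G \<and> P D'" by blast
  qed
  then show ?thesis unfolding P_def by blast
qed

lemma (in graph) card_independent_set_le:
  assumes "independent_set G S"
  shows "card S \<le> independence_number G"
proof -
  have "{S. independent_set G S} \<subseteq> Pow (verts G)"
    by (auto simp: independent_set_def)
  then have "finite {S. independent_set G S}" by (rule finite_subset) simp
  then show ?thesis
    unfolding independence_number_def using assms by (intro Max_ge) auto
qed

lemma (in graph) independence_number_ge_2:
  assumes "\<not> (\<exists>n. complete_digraph n G)"
  shows "2 \<le> independence_number G"
proof -
  have "arcs_ends G \<noteq> {(u, v). (u, v) \<in> verts G \<times> verts G \<and> u \<noteq> v}"
    using assms graph_axioms unfolding complete_digraph_def by blast
  moreover have "arcs_ends G \<subseteq> {(u, v). (u, v) \<in> verts G \<times> verts G \<and> u \<noteq> v}"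
    by (auto dest: adj_in_verts adj_not_same)
  ultimately obtain u v where uv: "u \<in> verts G" "v \<in> verts G" "u \<noteq> v" "\<not> u \<rightarrow>\<^bsub>G\<^esub> v"
    by blast
  moreover have "\<not> v \<rightarrow>\<^bsub>G\<^esub> u" using uv(4) arcs_ends_symmetric[OF sym_arcs, of v u] by blast
  ultimately have "independent_set G {u, v}"
    by (auto simp: independent_set_def dest: adj_not_same)
  from card_independent_set_le[OF this] uv(3) show ?thesis by simp
qed

section \<open>Order and zero forcing number\<close>

text \<open>
  Extra blue vertices never hurt: a force performed from \<open>B\<close> either remains possible or its
  target is already blue.
\<close>

lemma force_step_union:
  assumes "(force_step G)\<^sup>*\<^sup>* B D"
  shows "(force_step G)\<^sup>*\<^sup>* (B \<union> A) (D \<union> A)"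
  using assms
proof (induction rule: rtranclp_induct)
  case base
  show ?case by simp
next
  case (step C C')
  then obtain u w where u: "u \<in> C" and w: "white_neighbors G C u = {w}"
    and C': "C' = insert w C" unfolding force_step_def by blast
  show ?case
  proof (cases "w \<in> A")
    case True
    then have "C' \<union> A = C \<union> A" using C' by blast
    then show ?thesis using step.IH by simp
  next
    case False
    then have "white_neighbors G (C \<union> A) u = {w}"
      using w unfolding white_neighbors_def by blast
    then have "force_step G (C \<union> A) (C' \<union> A)"
      using u C' unfolding force_step_def by blast
    then show ?thesis using step.IH by simp
  qed
qed

text \<open>
  A blue vertex with \<open>k \<ge> 1\<close> white neighbours turns all of them blue at the price of colouring
  \<open>k - 1\<close> of them by hand.
\<close>

lemma force_all_but_one:
  assumes "(force_step G)\<^sup>*\<^sup>* B D" and "u \<in> D" and "w \<in> white_neighbors G D u"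
  shows "(force_step G)\<^sup>*\<^sup>* (B \<union> (white_neighbors G D u - {w})) (D \<union> white_neighbors G D u)"
proof -
  let ?W = "white_neighbors G D u"
  have "white_neighbors G (D \<union> (?W - {w})) u = {w}"
    using assms(3) unfolding white_neighbors_def by blast
  moreover have "D \<union> ?W = insert w (D \<union> (?W - {w}))" using assms(3) by blast
  ultimately have "force_step G (D \<union> (?W - {w})) (D \<union> ?W)"
    using assms(2) unfolding force_step_def by blast
  with force_step_union[OF assms(1)] show ?thesis by (rule rtranclp.rtrancl_into_rtrancl)
qed

text \<open>
  Start with a single blue vertex and apply \<open>force_all_but_one\<close> at the boundary of the blue set.
  The first round may involve \<open>\<Delta>\<close> white neighbours; it then produces \<open>\<Delta> + 1\<close> blue vertices from
  \<open>\<Delta>\<close> initial ones, and \<open>(\<Delta> - 1) \<Delta> = (\<Delta> - 2) (\<Delta> + 1) + 2\<close> explains the constant. Afterwards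
  every blue vertex has a blue neighbour, so a round gains some \<open>k \<le> \<Delta> - 1\<close> vertices, at a cost
  of \<open>k - 1 \<le> k (\<Delta> - 2) / (\<Delta> - 1)\<close>. The bound is written with \<open>\<Delta> = e + 2\<close>, which keeps it
  free of truncated subtraction.
\<close>

lemma (in graph) zero_forcing_set_card_bound:
  assumes conn: "Digraph_Component.connected G"
    and nontrivial: "card (verts G) \<ge> 2" and deg: "max_degree G = e + 2"
  shows "\<exists>B. zero_forcing_set G B \<and> (e + 1) * card B \<le> e * card (verts G) + 2"
proof -
  let ?W = "white_neighbors G"
  have W: "?W D u = {w. u \<rightarrow>\<^bsub>G\<^esub> w} - D" for D u by (auto simp: white_neighbors_def)
  have finW: "finite (?W D u)" for D u unfolding W using finite_dominated by blast
  define P where "P D \<longleftrightarrow> D \<noteq> {} \<and> (\<forall>u\<in>D. \<exists>x\<in>D. u \<rightarrow>\<^bsub>G\<^esub> x) \<and>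
    (\<exists>B. B \<subseteq> D \<and> (force_step G)\<^sup>*\<^sup>* B D \<and> (e + 1) * card B \<le> e * card D + 2)" for D
  obtain v where v: "v \<in> verts G"
    using conn unfolding Digraph_Component.connected_def strongly_connected_def by auto
  have "verts G \<noteq> {v}" using nontrivial by fastforce
  then have "{v} \<subset> verts G" using v by blast
  from connected_boundary_arc[OF conn _ this] obtain w0 where w0: "v \<rightarrow>\<^bsub>G\<^esub> w0" "w0 \<noteq> v"
    by blast
  have "P (verts G)"
  proof (rule growing_subset_exhausts[of _ "{v} \<union> ?W {v} v"])
    show "finite (verts G)" by simp
    show "{v} \<union> ?W {v} v \<subseteq> verts G" using v by (auto simp: W dest: adj_in_verts)
    have w0W: "w0 \<in> ?W {v} v" using w0 by (simp add: W)
    let ?B = "{v} \<union> (?W {v} v - {w0})"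
    have k: "card (?W {v} v) \<le> e + 2"
      using card_dominated_le_max_degree[OF v] deg
        card_mono[OF finite_dominated, of "?W {v} v" v] by (auto simp: W)
    have D: "card ({v} \<union> ?W {v} v) = card (?W {v} v) + 1"
      using finite_dominated by (subst card_Un_disjoint) (auto simp: W)
    have "v \<notin> ?W {v} v - {w0}" by (simp add: W)
    then have "card ?B = Suc (card (?W {v} v - {w0}))" using finW[of "{v}" v] by simp
    also have "\<dots> = card (?W {v} v)" by (rule card_Suc_Diff1[OF finW w0W])
    finally have B: "card ?B = card (?W {v} v)" .
    have "(e + 1) * card ?B \<le> e * card ({v} \<union> ?W {v} v) + 2"
      using k unfolding D B by (simp add: algebra_simps)
    moreover have "(force_step G)\<^sup>*\<^sup>* ?B ({v} \<union> ?W {v} v)"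
      using w0W by (intro force_all_but_one) auto
    moreover have "\<forall>u\<in>{v} \<union> ?W {v} v. \<exists>x\<in>{v} \<union> ?W {v} v. u \<rightarrow>\<^bsub>G\<^esub> x"
      using w0W arcs_ends_symmetric[OF sym_arcs, of v] unfolding W by blast
    moreover have "?B \<subseteq> {v} \<union> ?W {v} v" by blast
    ultimately show "P ({v} \<union> ?W {v} v)"
      unfolding P_def by (intro conjI exI[of _ ?B]) simp_all
  next
    fix D assume "P D" and D: "D \<subset> verts G"
    then obtain B where ne: "D \<noteq> {}" and nb: "\<forall>u\<in>D. \<exists>x\<in>D. u \<rightarrow>\<^bsub>G\<^esub> x"
      and B: "B \<subseteq> D" "(force_step G)\<^sup>*\<^sup>* B D" and le: "(e + 1) * card B \<le> e * card D + 2"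
      unfolding P_def by blast
    obtain u w where u: "u \<in> D" and w: "w \<in> verts G - D" and uw: "u \<rightarrow>\<^bsub>G\<^esub> w"
      by (rule connected_boundary_arc[OF conn ne D])
    have wW: "w \<in> ?W D u" using w uw by (simp add: W)
    let ?B = "B \<union> (?W D u - {w})" and ?D = "D \<union> ?W D u"
    have finD: "finite D" using D finite_verts by (meson finite_subset psubset_imp_subset)
    obtain x where "x \<in> D" "u \<rightarrow>\<^bsub>G\<^esub> x" using nb u by blast
    then have k: "card (?W D u) \<le> e + 1"
      using card_dominated_outside[of u x D] deg by (simp add: W)
    have cD: "card ?D = card D + card (?W D u)"
      using finD finW by (intro card_Un_disjoint) (auto simp: W)
    have "card ?B \<le> card B + card (?W D u - {w})" by (rule card_Un_le)
    then have cB: "card ?B + 1 \<le> card B + card (?W D u)"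
      using card_Suc_Diff1[OF finW wW] by linarith
    have "(e + 1) * (card ?B + 1) \<le> (e + 1) * (card B + card (?W D u))"
      using cB by (rule mult_le_mono2)
    then have "(e + 1) * card ?B \<le> e * card ?D + 2"
      using le k unfolding cD by (simp add: algebra_simps)
    moreover have "(force_step G)\<^sup>*\<^sup>* ?B ?D" using B(2) u wW by (rule force_all_but_one)
    moreover have "\<forall>u'\<in>?D. \<exists>x\<in>?D. u' \<rightarrow>\<^bsub>G\<^esub> x"
    proof
      fix u' assume u': "u' \<in> ?D"
      show "\<exists>x\<in>?D. u' \<rightarrow>\<^bsub>G\<^esub> x"
      proof (cases "u' \<in> D")
        case True
        then show ?thesis using nb by blast
      next
        case False
        then have "u' \<rightarrow>\<^bsub>G\<^esub> u" using u' arcs_ends_symmetric[OF sym_arcs, of u] unfolding W by blast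
        then show ?thesis using u by blast
      qed
    qed
    ultimately have "P ?D" using ne B(1) unfolding P_def by (intro conjI exI[of _ ?B]) auto
    moreover have "D \<subset> ?D" using w wW by blast
    moreover have "?D \<subseteq> verts G" using D by (auto simp: W dest: adj_in_verts)
    ultimately show "\<exists>D'. D \<subset> D' \<and> D' \<subseteq> verts G \<and> P D'" by blast
  qed
  then show ?thesis unfolding P_def zero_forcing_set_def by blast
qed

lemma (in graph) zero_forcing_number_le_card:
  assumes "zero_forcing_set G B"
  shows "zero_forcing_number G \<le> card B"
proof -
  have "{B. zero_forcing_set G B} \<subseteq> Pow (verts G)"
    by (auto simp: zero_forcing_set_def)
  then have "finite {B. zero_forcing_set G B}" by (rule finite_subset) simp
  then show ?thesis
    unfolding zero_forcing_number_def using assms by (intro Min_le) auto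
qed

section \<open>Zero forcing number and independence number\<close>

theorem theorem28:
  fixes G :: "('a,'b) pre_digraph"
  assumes "graph G"
    and "Digraph_Component.connected G"
    and "\<not> (\<exists>n. complete_digraph n G)"
    and "3 \<le> max_degree G"
  shows "zero_forcing_number G \<le> (max_degree G - 1) * independence_number G"
proof -
  interpret graph G by (rule assms(1))
  let ?a = "independence_number G" and ?n = "card (verts G)"
  obtain e where e: "max_degree G = e + 2"
    using assms(4) by (intro that[of "max_degree G - 2"]) simp
  have a: "2 \<le> ?a" using assms(3) by (rule independence_number_ge_2)
  obtain S where "independent_set G S" "?n \<le> max_degree G * card S + 1"
    using order_le_independent_set[OF assms(2)] by blast
  then have n: "?n \<le> (e + 2) * ?a + 1"
    using card_independent_set_le[of S] unfolding e by (meson add_le_mono1 le_trans mult_le_mono2)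
  obtain T where T: "independent_set G T" "card T = ?a"
    using independence_number_attained by blast
  then have "card T \<le> ?n" by (intro card_mono) (auto simp: independent_set_def)
  then have "2 \<le> ?n" using a T(2) by linarith
  from zero_forcing_set_card_bound[OF assms(2) this e] obtain B
    where B: "zero_forcing_set G B" "(e + 1) * card B \<le> e * ?n + 2" by blast
  have "(e + 1) * card B \<le> e * ((e + 2) * ?a + 1) + 2"
    using B(2) n by (meson add_le_mono1 le_trans mult_le_mono2)
  \<comment> \<open>The gap between the two sides is \<open>?a - 1\<close>, which is positive because \<open>G\<close> is not complete.\<close>
  also have "\<dots> < (e + 1) * ((e + 1) * ?a + 1)"
    using a by (simp add: algebra_simps)
  finally have "card B \<le> (e + 1) * ?a"
    by (simp only: mult_less_cancel1) simp
  with zero_forcing_number_le_card[OF B(1)] e show ?thesis by simp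
qed

end
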